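(* Let $\Lambda$ be a real infinite-dimensional Hilbert space, let $\mathcal{C}\subset\Lambda$ be a non-empty, closed and convex subset, and let $J:\Lambda\to\mathbb{R}$ be a lower semi-continuous, convex and coercive functional. Then $J$ achieves its minimum in $\mathcal{C}$, i.e., there exists $\bar{\lambda}\in\mathcal{C}$ such that $J(\bar{\lambda})=\inf_{\lambda\in\mathcal{C}}J(\lambda)$.
   Context: A functional $J$ on a topological space $\Lambda$ is lower semi-continuous if for each $a\in\mathbb{R}$ the sublevel set $\{\lambda\in\Lambda: J(\lambda)\le a\}$ is closed in $\Lambda$. Here "closed" and "lower semi-continuous" refer to the strong (norm) topology of $\Lambda$. A functional $J:\Lambda\to\mathbb{R}$ is coercive if $J(u)\to+\infty$ as $\|u\|\to+\infty$, $u\in\Lambda$. *)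

theory Defs
  imports "HOL-Analysis.Analysis"
begin

definition lower_semicontinuous :: "('a::topological_space \<Rightarrow> real) \<Rightarrow> bool" where
  "lower_semicontinuous J \<longleftrightarrow> (\<forall>a. closed {x. J x \<le> a})"

definition coercive :: "('a::real_normed_vector \<Rightarrow> real) \<Rightarrow> bool" where
  "coercive J \<longleftrightarrow> filterlim J at_top at_infinity"

(* The library constant dim is 0 on spaces without a finite basis, so it cannot be
   used to express that the whole space is infinite-dimensional. *)
definition infinite_dimensional :: "'a::real_vector itself \<Rightarrow> bool" where
  "infinite_dimensional _ \<longleftrightarrow> (\<nexists>B::'a set. finite B \<and> span B = UNIV)"

end

theory Submission
  imports Defs
begin

text \<open>
  This is the direct method of the calculus of variations. Take levels decreasing to the infimum
  of \<open>J\<close> on \<open>C\<close>. The corresponding sublevel sets of \<open>J\<close>, intersected with \<open>C\<close>, form a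
  decreasing sequence of non-empty sets, closed by lower semi-continuity, convex by convexity
  and bounded by coercivity. A point common to all of them is a minimizer. The same argument
  with levels tending to \<open>-\<infinity>\<close> (\<open>point_below_all_levels\<close> covers both) would give a point with
  value \<open>-\<infinity>\<close> if \<open>J\<close> were unbounded below on \<open>C\<close>, so the infimum is finite.

  Usually such a common point comes from weak compactness. Here it is found with the norm alone
  (\<open>decreasing_closed_convex_bounded_nest\<close>): the points of these sets that almost minimize the
  distance to the origin form, by the parallelogram law, sets of diameter tending to zero, so that
  Cantor's intersection theorem applies.
\<close>

lemma parallelogram_law_midpoint:
  fixes x y :: "'a::real_inner"
  shows "(dist x y)\<^sup>2 = 2 * (norm x)\<^sup>2 + 2 * (norm y)\<^sup>2 - 4 * (norm (midpoint x y))\<^sup>2"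
  unfolding dist_norm midpoint_def power2_norm_eq_inner
  by (simp add: inner_simps inner_commute[of y x] field_simps)

text \<open>
  In a convex set at distance \<open>d\<close> from the origin, midpoints have norm at least \<open>d\<close>, so the
  parallelogram law forces points of norm close to \<open>d\<close> to be close to each other.
\<close>

lemma dist_le_if_almost_minimal_norm:
  fixes S :: "'a::real_inner set"
  assumes "convex S" "x \<in> S" "y \<in> S" "norm x \<le> r" "norm y \<le> r"
  shows "(dist x y)\<^sup>2 \<le> 4 * (r\<^sup>2 - (infdist 0 S)\<^sup>2)"
proof -
  have "midpoint x y \<in> S"
    using closed_segment_subset[OF assms(2,3,1)] midpoint_in_closed_segment by blast
  then have "infdist 0 S \<le> norm (midpoint x y)"
    by (metis infdist_le dist_0_norm)
  then have "(infdist 0 S)\<^sup>2 \<le> (norm (midpoint x y))\<^sup>2"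
    by (simp add: infdist_nonneg power_mono)
  moreover have "(norm x)\<^sup>2 \<le> r\<^sup>2" "(norm y)\<^sup>2 \<le> r\<^sup>2"
    using assms by (auto intro: power_mono)
  ultimately show ?thesis
    unfolding parallelogram_law_midpoint by (simp add: algebra_simps)
qed

text \<open>
  This replaces weak compactness of bounded closed convex sets. The distances from the origin to
  the sets increase to a finite limit \<open>D\<close> by boundedness; cutting the \<open>n\<close>-th set with a ball
  of radius slightly above \<open>D\<close> keeps it non-empty and makes the diameters tend to zero.
\<close>

lemma decreasing_closed_convex_bounded_nest:
  fixes S :: "nat \<Rightarrow> 'a::{real_inner, complete_space} set"
  assumes closed: "\<And>n. closed (S n)" and convex: "\<And>n. convex (S n)"
    and nonempty: "\<And>n. S n \<noteq> {}" and decreasing: "\<And>m n. m \<le> n \<Longrightarrow> S n \<subseteq> S m"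
    and bounded: "bounded (S 0)"
  shows "\<exists>a. \<forall>n. a \<in> S n"
proof -
  define d where "d n = infdist 0 (S n)" for n
  obtain B where B: "\<And>x. x \<in> S 0 \<Longrightarrow> norm x \<le> B"
    using bounded by (auto simp: bounded_iff)
  have "d n \<le> B" for n
  proof -
    obtain x where x: "x \<in> S n" using nonempty by blast
    then have "d n \<le> norm x"
      unfolding d_def by (metis infdist_le dist_0_norm)
    also have "\<dots> \<le> B" using x decreasing[of 0 n] B by auto
    finally show ?thesis .
  qed
  then have bdd: "bdd_above (range d)" by (rule bdd_aboveI2)
  have inc: "incseq d"
    unfolding incseq_def d_def by (auto intro!: infdist_mono decreasing nonempty)
  define D where "D = (SUP n. d n)"
  have lim_d: "d \<longlonglongrightarrow> D"
    unfolding D_def by (rule LIMSEQ_incseq_SUP[OF bdd inc])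
  define r where "r n = D + inverse (real (Suc n))" for n
  have lim_r: "r \<longlonglongrightarrow> D"
    unfolding r_def by (rule LIMSEQ_inverse_real_of_nat_add)
  have lim: "(\<lambda>n. 4 * ((r n)\<^sup>2 - (d n)\<^sup>2)) \<longlonglongrightarrow> 4 * (D\<^sup>2 - D\<^sup>2)"
    by (intro tendsto_intros lim_d lim_r)
  define T where "T n = S n \<inter> cball 0 (r n)" for n
  have "\<exists>a. \<Inter>(range T) = {a}"
  proof (rule decreasing_closed_nest_sing)
    show "closed (T n)" for n
      unfolding T_def by (intro closed_Int closed closed_cball)
    show "T n \<noteq> {}" for n
    proof -
      have "d n \<le> D" unfolding D_def by (rule cSUP_upper[OF UNIV_I bdd])
      then have "infdist 0 (S n) < r n"
        by (simp add: r_def d_def order_le_less_trans)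
      then obtain x where "x \<in> S n" "dist 0 x < r n"
        using nonempty[of n] cInf_lessD[of "dist 0 ` S n" "r n"]
        by (auto simp: infdist_notempty)
      then show ?thesis by (auto simp: T_def)
    qed
    show "T n \<subseteq> T m" if "m \<le> n" for m n
    proof -
      have "r n \<le> r m" using that by (simp add: r_def le_imp_inverse_le)
      then show ?thesis using decreasing[OF that] by (auto simp: T_def)
    qed
    show "\<exists>n. \<forall>x\<in>T n. \<forall>y\<in>T n. dist x y < e" if "e > 0" for e
    proof -
      have "\<forall>\<^sub>F n in sequentially. 4 * ((r n)\<^sup>2 - (d n)\<^sup>2) < e\<^sup>2"
        using lim that by (intro order_tendstoD(2)) auto
      then obtain n where n: "4 * ((r n)\<^sup>2 - (d n)\<^sup>2) < e\<^sup>2"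
        by (auto simp: eventually_sequentially)
      have "dist x y < e" if "x \<in> T n" "y \<in> T n" for x y
      proof (rule power_less_imp_less_base)
        have "(dist x y)\<^sup>2 \<le> 4 * ((r n)\<^sup>2 - (d n)\<^sup>2)"
          unfolding d_def using that
          by (intro dist_le_if_almost_minimal_norm convex) (auto simp: T_def)
        with n show "(dist x y)\<^sup>2 < e\<^sup>2" by linarith
      qed (use \<open>e > 0\<close> in simp)
      then show ?thesis by blast
    qed
  qed
  then obtain a where "a \<in> \<Inter>(range T)" by blast
  then show ?thesis by (auto simp: T_def)
qed

lemma coercive_imp_bounded_sublevel:
  assumes "coercive J"
  shows "bounded {x. J x \<le> a}"
proof -
  have "\<forall>\<^sub>F x in at_infinity. a < J x"
    using assms unfolding coercive_def filterlim_at_top_dense by blast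
  then obtain b where "\<And>x. b \<le> norm x \<Longrightarrow> a < J x"
    by (auto simp: eventually_at_infinity)
  then have "norm x \<le> b" if "J x \<le> a" for x
    using that by (meson linorder_le_cases linorder_not_le)
  then show ?thesis by (auto simp: bounded_iff)
qed

lemma convex_on_imp_convex_sublevel:
  assumes "convex_on UNIV J"
  shows "convex {x. J x \<le> a}"
proof (rule convexI)
  fix x y and u v :: real
  assume *: "x \<in> {x. J x \<le> a}" "y \<in> {x. J x \<le> a}" "0 \<le> u" "0 \<le> v" "u + v = 1"
  then have "J (u *\<^sub>R x + v *\<^sub>R y) \<le> u * J x + v * J y"
    using assms by (simp add: convex_on_def)
  also have "\<dots> \<le> a"
    using * by (intro convex_bound_le) auto
  finally show "u *\<^sub>R x + v *\<^sub>R y \<in> {x. J x \<le> a}" by simp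
qed

text \<open>
  The levels are left arbitrary so that the lemma serves twice: with levels \<open>- n\<close> it excludes that
  \<open>J\<close> is unbounded below on \<open>C\<close>, and with levels decreasing to the infimum it produces the
  minimizer.
\<close>

lemma point_below_all_levels:
  fixes J :: "'a::{real_inner, complete_space} \<Rightarrow> real"
  assumes "closed C" "convex C" "lower_semicontinuous J" "convex_on UNIV J" "coercive J"
    and "decseq a" and attained: "\<And>n. \<exists>x\<in>C. J x \<le> a n"
  shows "\<exists>l\<in>C. \<forall>n. J l \<le> a n"
proof -
  have "\<exists>l. \<forall>n. l \<in> C \<inter> {x. J x \<le> a n}"
  proof (rule decreasing_closed_convex_bounded_nest)
    show "closed (C \<inter> {x. J x \<le> a n})" for n
      using assms by (auto simp: lower_semicontinuous_def)
    show "convex (C \<inter> {x. J x \<le> a n})" for n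
      using assms by (intro convex_Int convex_on_imp_convex_sublevel)
    show "C \<inter> {x. J x \<le> a n} \<noteq> {}" for n
      using attained by blast
    show "C \<inter> {x. J x \<le> a n} \<subseteq> C \<inter> {x. J x \<le> a m}" if "m \<le> n" for m n
      using decseqD[OF \<open>decseq a\<close> that] by auto
    show "bounded (C \<inter> {x. J x \<le> a 0})"
      using assms by (simp add: coercive_imp_bounded_sublevel bounded_Int)
  qed
  then show ?thesis by blast
qed

theorem corollary2:
  fixes J :: "'a::{real_inner, complete_space} \<Rightarrow> real" and C :: "'a set"
  assumes "infinite_dimensional TYPE('a)"
    and "C \<noteq> {}" and "closed C" and "convex C"
    and "lower_semicontinuous J" and "convex_on UNIV J" and "coercive J"
  shows "\<exists>l\<in>C. (\<forall>x\<in>C. J l \<le> J x) \<and> J l = (INF x\<in>C. J x)"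
proof -
  note below_all_levels = point_below_all_levels[OF assms(3-7)]
  have bdd: "bdd_below (J ` C)"
  proof (rule ccontr)
    assume unbounded: "\<not> bdd_below (J ` C)"
    have "\<exists>l\<in>C. \<forall>n. J l \<le> - real n"
    proof (rule below_all_levels)
      show "\<exists>x\<in>C. J x \<le> - real n" for n
        using unbounded by (meson bdd_belowI2 linorder_le_cases)
    qed (simp add: decseq_def)
    then obtain l where l: "\<And>n. J l \<le> - real n" by blast
    obtain n where "- J l < real n" using reals_Archimedean2 by blast
    with l[of n] show False by linarith
  qed
  define m where "m = (INF x\<in>C. J x)"
  have "\<exists>l\<in>C. \<forall>n. J l \<le> m + inverse (real (Suc n))"
  proof (rule below_all_levels)
    show "decseq (\<lambda>n. m + inverse (real (Suc n)))"
      by (simp add: decseq_def le_imp_inverse_le)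
    show "\<exists>x\<in>C. J x \<le> m + inverse (real (Suc n))" for n
    proof -
      have "(INF x\<in>C. J x) < m + inverse (real (Suc n))" by (simp add: m_def)
      then show ?thesis
        using cINF_less_iff[OF \<open>C \<noteq> {}\<close> bdd] less_imp_le by blast
    qed
  qed
  then obtain l where "l \<in> C" and l: "\<And>n. J l \<le> m + inverse (real (Suc n))" by blast
  have "(\<lambda>n. m + inverse (real (Suc n))) \<longlonglongrightarrow> m"
    by (rule LIMSEQ_inverse_real_of_nat_add)
  then have "J l \<le> m"
    using l by (intro LIMSEQ_le_const) auto
  moreover have "m \<le> J x" if "x \<in> C" for x
    unfolding m_def using bdd that by (rule cINF_lower)
  ultimately show ?thesis
    using \<open>l \<in> C\<close> unfolding m_def[symmetric] by (meson order_antisym order_trans)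
qed

end
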